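(* Let $n,s,r$ be positive integers with $r\le \min(n,s)$, let $\mathbf V\in\mathbb R^{n\times s}$, and let $\mathbf p=[p_1,\dots,p_r]$ and $\mathbf s=[s_1,\dots,s_r]$ be vectors of distinct row indices in $\{1,\dots,n\}$ and distinct column indices in $\{1,\dots,s\}$, with indexing matrices $\mathbf P=\mathbf I_n(:,\mathbf p)\in\mathbb R^{n\times r}$ and $\mathbf S=\mathbf I_s(:,\mathbf s)\in\mathbb R^{s\times r}$. Let $\hat{\mathbf V}=\mathbf Q\mathbf Z$ be the low-rank approximation of $\mathbf V$ computed by the TDB-CUR algorithm: $\mathbf V(:,\mathbf s)=\mathbf Q\mathbf R$ is a QR decomposition with $\mathbf Q\in\mathbb R^{n\times r}$ having orthonormal columns and $\mathbf R\in\mathbb R^{r\times r}$; $\mathbf Q(\mathbf p,:)$ is invertible and $\mathbf Z=\mathbf Q(\mathbf p,:)^{-1}\mathbf V(\mathbf p,:)\in\mathbb R^{r\times s}$; $\mathbf Z=\mathbf U_{\mathbf Z}\boldsymbol\Sigma\mathbf Y^T$ is a (thin) singular value decomposition with $\mathbf U_{\mathbf Z}\in\mathbb R^{r\times r}$ orthogonal, $\boldsymbol\Sigma\in\mathbb R^{r\times r}$ diagonal with nonnegative entries, and $\mathbf Y\in\mathbb R^{s\times r}$ with orthonormal columns; and $\mathbf U=\mathbf Q\mathbf U_{\mathbf Z}\in\mathbb R^{n\times r}$. Assume $\mathbf Y^T\mathbf S$ is invertible, and define the oblique projectors onto $\mathrm{Ran}(\mathbf U)$ and $\mathrm{Ran}(\mathbf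 Y)$, respectively, by $$\mathbf P_{\mathbf U}^{\mathrm{obl}}=\mathbf U(\mathbf P^T\mathbf U)^{-1}\mathbf P^T,\qquad \mathbf P_{\mathbf Y}^{\mathrm{obl}}=\mathbf S(\mathbf Y^T\mathbf S)^{-1}\mathbf Y^T .$$ Then $$\hat{\mathbf V}=\mathbf P_{\mathbf U}^{\mathrm{obl}}\,\mathbf V\,\mathbf P_{\mathbf Y}^{\mathrm{obl}} .$$
   Context: $\mathbf I_k$ is the $k\times k$ identity matrix. MATLAB indexing is used: for an index vector $\mathbf p$, $\mathbf A(\mathbf p,:)$ is the submatrix of $\mathbf A$ formed by the rows listed in $\mathbf p$ (in that order), and $\mathbf A(:,\mathbf s)$ is the submatrix formed by the columns listed in $\mathbf s$. Thus $\mathbf P^T\mathbf A=\mathbf A(\mathbf p,:)$ and $\mathbf A\mathbf S=\mathbf A(:,\mathbf s)$. The integer $s$ (number of columns) is distinct from the bold index vector $\mathbf s$. The matrix $\mathbf P^T\mathbf U=\mathbf Q(\mathbf p,:)\mathbf U_{\mathbf Z}$ is invertible because $\mathbf Q(\mathbf p,:)$ is. The projector $\mathbf P_{\mathbf U}^{\mathrm{obl}}$ acts from the left and $\mathbf P_{\mathbf Y}^{\mathrm{obl}}$ from the right. *)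

theory Defs
  imports Complex_Main "Jordan_Normal_Form.Gauss_Jordan_Elimination"
begin

text \<open>
  Index vectors are lists of indices counted from 0, as for matrix entries: an index vector
  for \<open>n\<close> rows (or columns) is a list with entries in \<open>{0..<n}\<close>.
  \<open>rows_at A p\<close> and \<open>cols_at A q\<close> are \<open>A(p,:)\<close> and \<open>A(:,q)\<close> in MATLAB notation; unlike
  \<open>submatrix\<close>, which selects by index sets, they keep the order of the list.
\<close>

definition index_vector :: "nat \<Rightarrow> nat \<Rightarrow> nat list \<Rightarrow> bool" where
  "index_vector n r p \<longleftrightarrow> length p = r \<and> distinct p \<and> set p \<subseteq> {0..<n}"

definition rows_at :: "'a mat \<Rightarrow> nat list \<Rightarrow> 'a mat" where
  "rows_at A p = mat (length p) (dim_col A) (\<lambda>(i, j). A $$ (p ! i, j))"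

definition cols_at :: "'a mat \<Rightarrow> nat list \<Rightarrow> 'a mat" where
  "cols_at A q = mat (dim_row A) (length q) (\<lambda>(i, j). A $$ (i, q ! j))"

text \<open>The library function \<open>mat_inverse\<close> returns \<open>None\<close> on singular matrices, so the following
  is meaningful only for invertible \<open>A\<close>.\<close>

definition inv_mat :: "'a::field mat \<Rightarrow> 'a mat" where
  "inv_mat A = the (mat_inverse A)"

lemma inv_mat:
  fixes A :: "'a::field mat"
  assumes A: "A \<in> carrier_mat n n" and inv: "invertible_mat A"
  shows "inv_mat A \<in> carrier_mat n n" "A * inv_mat A = 1\<^sub>m n" "inv_mat A * A = 1\<^sub>m n"
proof -
  obtain B where B: "A * B = 1\<^sub>m n" "B * A = 1\<^sub>m (dim_row B)"
    using inv A unfolding invertible_mat_def inverts_mat_def by auto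
  have "dim_col B = n" using arg_cong[OF B(1), of dim_col] by simp
  moreover have "dim_row B = n" using arg_cong[OF B(2), of dim_col] A by simp
  ultimately have "B \<in> carrier_mat n n" by auto
  then have "A \<in> Units (ring_mat TYPE('a) n ())"
    using A B by (auto simp: Units_def ring_mat_def)
  then obtain C where "mat_inverse A = Some C"
    using mat_inverse(1)[OF A, where b = "()"] by (cases "mat_inverse A") auto
  then show "inv_mat A \<in> carrier_mat n n" "A * inv_mat A = 1\<^sub>m n" "inv_mat A * A = 1\<^sub>m n"
    using mat_inverse(2)[OF A] by (auto simp: inv_mat_def)
qed

text \<open>The library's \<open>orthogonal_mat\<close> only asks the columns to be nonzero and pairwise
  orthogonal. For a square matrix the notion below is orthogonality in the usual sense.\<close>

definition orthonormal_cols :: "real mat \<Rightarrow> bool" where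
  "orthonormal_cols A \<longleftrightarrow> A\<^sup>T * A = 1\<^sub>m (dim_col A)"

text \<open>\<open>A = Q R\<close> with \<open>A\<close> of size \<open>n \<times> r\<close>, in the thin form.\<close>

definition qr_decomposition :: "nat \<Rightarrow> nat \<Rightarrow> real mat \<Rightarrow> real mat \<Rightarrow> real mat \<Rightarrow> bool" where
  "qr_decomposition n r A Q R \<longleftrightarrow>
     Q \<in> carrier_mat n r \<and> orthonormal_cols Q \<and>
     R \<in> carrier_mat r r \<and> upper_triangular R \<and>
     A = Q * R"

text \<open>\<open>A = U \<Sigma> Y\<^sup>T\<close> with \<open>A\<close> of size \<open>r \<times> s\<close>, \<open>r \<le> s\<close>; so the thin left factor is square. The singular
  values need not be sorted.\<close>

definition thin_svd ::
    "nat \<Rightarrow> nat \<Rightarrow> real mat \<Rightarrow> real mat \<Rightarrow> real mat \<Rightarrow> real mat \<Rightarrow> bool" where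
  "thin_svd r s A U \<Sigma> Y \<longleftrightarrow>
     U \<in> carrier_mat r r \<and> orthonormal_cols U \<and>
     \<Sigma> \<in> carrier_mat r r \<and> diagonal_mat \<Sigma> \<and> (\<forall>i<r. 0 \<le> \<Sigma> $$ (i, i)) \<and>
     Y \<in> carrier_mat s r \<and> orthonormal_cols Y \<and>
     A = U * \<Sigma> * Y\<^sup>T"

end

theory Submission
  imports Defs "Jordan_Normal_Form.Determinant"
begin

text \<open>Since \<open>U\<^sub>Z\<close> is invertible, it cancels in the left projector: \<open>P_U = Q Q(p,:)\<^sup>-\<^sup>1 P\<^sup>T\<close>, so \<open>P_U V = Q Z\<close>
  is already \<open>V_hat\<close>. The rows of \<open>V_hat = Q U\<^sub>Z \<Sigma> Y\<^sup>T\<close> lie in the range of \<open>Y\<close>, and the right projector fixes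
  such matrices because \<open>Y\<^sup>T P_Y = Y\<^sup>T\<close>.\<close>

text \<open>Row \<open>i\<close> of the transposed selection matrix is the unit vector at position
  \<open>p ! i\<close>, so each entry of the product is a sum with a single surviving term. The
  range condition on \<open>p\<close> guarantees that this position occurs in the sum.\<close>

lemma transpose_cols_at_one_mult:
  fixes A :: "'a::semiring_1 mat"
  assumes A: "A \<in> carrier_mat n m" and p: "set p \<subseteq> {0..<n}"
  shows "(cols_at (1\<^sub>m n) p)\<^sup>T * A = rows_at A p"
proof (rule eq_matI)
  fix i j assume "i < dim_row (rows_at A p)" "j < dim_col (rows_at A p)"
  then have i: "i < length p" and j: "j < m" using A by (auto simp: rows_at_def)
  then have pi: "p ! i < n" using p nth_mem by fastforce
  have "((cols_at (1\<^sub>m n) p)\<^sup>T * A) $$ (i, j) = (\<Sum>k<n. (if k = p ! i then 1 else 0) * A $$ (k, j))"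
    using A i j pi by (simp add: scalar_prod_def cols_at_def atLeast0LessThan)
  also have "\<dots> = (\<Sum>k<n. if k = p ! i then A $$ (k, j) else 0)"
    by (rule sum.cong) auto
  also have "\<dots> = rows_at A p $$ (i, j)"
    using A i j pi by (simp add: rows_at_def)
  finally show "((cols_at (1\<^sub>m n) p)\<^sup>T * A) $$ (i, j) = rows_at A p $$ (i, j)" .
qed (use A in \<open>auto simp: rows_at_def cols_at_def\<close>)

text \<open>Over a field, a one-sided inverse of a square matrix is two-sided, so checking the
  product on one side yields both invertibility and, by uniqueness, the value of
  \<open>inv_mat A\<close>.\<close>

lemma inv_mat_eqI:
  fixes A B :: "'a::field mat"
  assumes A: "A \<in> carrier_mat n n" and B: "B \<in> carrier_mat n n" and BA: "B * A = 1\<^sub>m n"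
  shows "inv_mat A = B"
proof -
  have AB: "A * B = 1\<^sub>m n" by (rule mat_mult_left_right_inverse[OF B A BA])
  then have "invertible_mat A"
    using A B BA by (auto simp: invertible_mat_def inverts_mat_def)
  note I = inv_mat[OF A this]
  have "inv_mat A = B * A * inv_mat A" using BA I(1) by simp
  also have "\<dots> = B * (A * inv_mat A)" by (rule assoc_mult_mat[OF B A I(1)])
  finally show ?thesis using B I(2) by simp
qed

text \<open>Reassociating brings \<open>Y\<^sup>T * S\<close> next to its inverse, leaving only the
  last factor \<open>Y\<^sup>T\<close>. The free factor \<open>X\<close> lets this apply to any
  matrix whose rows are combinations of the columns of \<open>Y\<close>.\<close>

lemma mult_oblique_projector:
  fixes X Y S :: "real mat"
  assumes X: "X \<in> carrier_mat n r" and Y: "Y \<in> carrier_mat s r" and S: "S \<in> carrier_mat s r"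
    and inv: "invertible_mat (Y\<^sup>T * S)"
  shows "X * Y\<^sup>T * (S * inv_mat (Y\<^sup>T * S) * Y\<^sup>T) = X * Y\<^sup>T"
proof -
  have YS: "Y\<^sup>T * S \<in> carrier_mat r r" and Yt: "Y\<^sup>T \<in> carrier_mat r s" using Y S by auto
  note I = inv_mat[OF YS inv]
  have "Y\<^sup>T * (S * inv_mat (Y\<^sup>T * S) * Y\<^sup>T) = Y\<^sup>T * (S * inv_mat (Y\<^sup>T * S)) * Y\<^sup>T"
    by (rule assoc_mult_mat[symmetric]) (use S Yt I(1) in auto)
  also have "Y\<^sup>T * (S * inv_mat (Y\<^sup>T * S)) = Y\<^sup>T * S * inv_mat (Y\<^sup>T * S)"
    by (rule assoc_mult_mat[symmetric, OF Yt S I(1)])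
  finally have "Y\<^sup>T * (S * inv_mat (Y\<^sup>T * S) * Y\<^sup>T) = Y\<^sup>T"
    using I(2) Yt by simp
  moreover have "X * Y\<^sup>T * (S * inv_mat (Y\<^sup>T * S) * Y\<^sup>T) = X * (Y\<^sup>T * (S * inv_mat (Y\<^sup>T * S) * Y\<^sup>T))"
    by (rule assoc_mult_mat[OF X Yt]) (use S Yt I(1) in auto)
  ultimately show ?thesis by simp
qed

theorem theorem2:
  fixes n s r :: nat
    and V P S Q R Z U\<^sub>Z \<Sigma> Y U V_hat P_U P_Y :: "real mat"
    and p_idx s_idx :: "nat list"
  assumes "0 < n" and "0 < s" and "0 < r" and "r \<le> min n s"
    and "V \<in> carrier_mat n s"
    and "index_vector n r p_idx" and "index_vector s r s_idx"
    and "P = cols_at (1\<^sub>m n) p_idx" and "S = cols_at (1\<^sub>m s) s_idx"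
    and "qr_decomposition n r (cols_at V s_idx) Q R"
    and "invertible_mat (rows_at Q p_idx)"
    and "Z = inv_mat (rows_at Q p_idx) * rows_at V p_idx"
    and "V_hat = Q * Z"
    and "thin_svd r s Z U\<^sub>Z \<Sigma> Y"
    and "U = Q * U\<^sub>Z"
    and "invertible_mat (Y\<^sup>T * S)"
    and "P_U = U * inv_mat (P\<^sup>T * U) * P\<^sup>T"
    and "P_Y = S * inv_mat (Y\<^sup>T * S) * Y\<^sup>T"
  shows "V_hat = P_U * V * P_Y"
proof -
  have V: "V \<in> carrier_mat n s" by fact
  have p: "length p_idx = r" "set p_idx \<subseteq> {0..<n}"
    and s: "length s_idx = r"
    using \<open>index_vector n r p_idx\<close> \<open>index_vector s r s_idx\<close> by (auto simp: index_vector_def)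
  have Q: "Q \<in> carrier_mat n r"
    using \<open>qr_decomposition n r _ Q R\<close> by (simp add: qr_decomposition_def)
  have UZ: "U\<^sub>Z \<in> carrier_mat r r" "U\<^sub>Z\<^sup>T * U\<^sub>Z = 1\<^sub>m r"
    and Sig: "\<Sigma> \<in> carrier_mat r r" and Y: "Y \<in> carrier_mat s r" and Z_svd: "Z = U\<^sub>Z * \<Sigma> * Y\<^sup>T"
    using \<open>thin_svd r s Z U\<^sub>Z \<Sigma> Y\<close> by (auto simp: thin_svd_def orthonormal_cols_def)
  have UZt: "U\<^sub>Z\<^sup>T \<in> carrier_mat r r" using UZ by simp
  \<comment> \<open>Orthonormal columns give only the product in the other order; squareness of
    \<open>U\<^sub>Z\<close> turns the left inverse into a right inverse.\<close>
  have UZ_right: "U\<^sub>Z * U\<^sub>Z\<^sup>T = 1\<^sub>m r" by (rule mat_mult_left_right_inverse[OF UZt UZ])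
  have P: "P \<in> carrier_mat n r" and S: "S \<in> carrier_mat s r"
    using p s \<open>P = _\<close> \<open>S = _\<close> by (auto simp: cols_at_def)
  have Pt: "P\<^sup>T \<in> carrier_mat r n" using P by simp
  define G where "G = rows_at Q p_idx"
  have G: "G \<in> carrier_mat r r" using p Q by (auto simp: G_def rows_at_def)
  have "invertible_mat G" using \<open>invertible_mat (rows_at Q p_idx)\<close> by (simp add: G_def)
  note I = inv_mat[OF G this]
  have PQ: "P\<^sup>T * Q = G" and PV: "P\<^sup>T * V = rows_at V p_idx"
    using transpose_cols_at_one_mult[OF _ p(2)] Q V \<open>P = _\<close> by (auto simp: G_def)
  have PU: "P\<^sup>T * U = G * U\<^sub>Z"
    using assoc_mult_mat[OF Pt Q UZ(1)] \<open>U = _\<close> PQ by simp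
  \<comment> \<open>The candidate inverse of \<open>G * U\<^sub>Z\<close> is the product of the
    inverses in reverse order, with the transpose of \<open>U\<^sub>Z\<close> as its
    inverse.\<close>
  have "U\<^sub>Z\<^sup>T * inv_mat G * (G * U\<^sub>Z) = U\<^sub>Z\<^sup>T * (inv_mat G * (G * U\<^sub>Z))"
    by (rule assoc_mult_mat) (use UZt I(1) G UZ in auto)
  also have "inv_mat G * (G * U\<^sub>Z) = inv_mat G * G * U\<^sub>Z"
    by (rule assoc_mult_mat[symmetric, OF I(1) G UZ(1)])
  finally have "U\<^sub>Z\<^sup>T * inv_mat G * (G * U\<^sub>Z) = 1\<^sub>m r" using I(3) UZ by simp
  then have inv_PU: "inv_mat (P\<^sup>T * U) = U\<^sub>Z\<^sup>T * inv_mat G"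
    unfolding PU by (intro inv_mat_eqI) (use UZt I(1) G UZ in auto)
  \<comment> \<open>Here \<open>U\<^sub>Z\<close> meets its transpose on the right, so
    \<open>UZ_right\<close> removes the SVD factor from the left projector.\<close>
  have "U * (U\<^sub>Z\<^sup>T * inv_mat G) = Q * (U\<^sub>Z * (U\<^sub>Z\<^sup>T * inv_mat G))"
    unfolding \<open>U = _\<close> by (rule assoc_mult_mat[OF Q UZ(1)]) (use UZt I(1) in auto)
  also have "U\<^sub>Z * (U\<^sub>Z\<^sup>T * inv_mat G) = inv_mat G"
    using assoc_mult_mat[OF UZ(1) UZt I(1)] UZ_right I(1) by simp
  finally have P_U: "P_U = Q * inv_mat G * P\<^sup>T"
    using \<open>P_U = _\<close> inv_PU by simp
  have "P_U * V = Q * inv_mat G * (P\<^sup>T * V)"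
    unfolding P_U by (rule assoc_mult_mat[OF _ Pt V]) (use Q I(1) in auto)
  \<comment> \<open>In this grouping the bracket is exactly \<open>Z\<close>, since
    \<open>P\<^sup>T * V\<close> selects the rows \<open>p_idx\<close> of \<open>V\<close>.\<close>
  also have "\<dots> = Q * (inv_mat G * (P\<^sup>T * V))"
    by (rule assoc_mult_mat[OF Q I(1)]) (use Pt V in auto)
  finally have left: "P_U * V = V_hat"
    using PV \<open>V_hat = _\<close> \<open>Z = inv_mat _ * _\<close> by (simp add: G_def)
  \<comment> \<open>Grouping all factors before \<open>Y\<^sup>T\<close> gives the \<open>X\<close>
    to which \<open>mult_oblique_projector\<close> applies.\<close>
  have "V_hat = Q * (U\<^sub>Z * \<Sigma>) * Y\<^sup>T"
    unfolding \<open>V_hat = _\<close> Z_svd by (rule assoc_mult_mat[symmetric, OF Q]) (use UZ Sig Y in auto)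
  moreover have "Q * (U\<^sub>Z * \<Sigma>) \<in> carrier_mat n r" using Q UZ Sig by auto
  ultimately have "V_hat * P_Y = V_hat"
    using mult_oblique_projector[OF _ Y S \<open>invertible_mat (Y\<^sup>T * S)\<close>] \<open>P_Y = _\<close> by metis
  then show ?thesis using left by simp
qed

end
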